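(* For every 3-periodic $T$ of $E$ at which they are defined, the centers $X_{88}$ (trilinears $h=\dfrac{1}{s_2+s_3-2s_1}$) and $X_{100}$ (trilinears $h=\dfrac{1}{s_2-s_3}$) lie on $E$, and the closure of the locus of each of them is all of $E$.
   Context: Fix real numbers $a>b>0$ and let $E$ be the ellipse $x^2/a^2+y^2/b^2=1$. A 3-periodic is a non-degenerate triangle $P_1P_2P_3$ with all vertices on $E$ such that at each vertex $P_j$ the normal line to $E$ at $P_j$ bisects the interior angle of the triangle at $P_j$. For a triangle let $s_1=|P_2P_3|$, $s_2=|P_3P_1|$, $s_3=|P_1P_2|$. Given a function $h(s_1,s_2,s_3)$, the center $X_h$ is the point with trilinears $p:q:r=h(s_1,s_2,s_3):h(s_2,s_3,s_1):h(s_3,s_1,s_2)$, i.e. the Cartesian point $\dfrac{p s_1P_1+q s_2P_2+r s_3P_3}{p s_1+q s_2+r s_3}$, defined when all of $p,q,r$ are defined and the denominator is nonzero. The locus of $X_h$ is the set of points $X_h(T)$ over all 3-periodics $T$ for which it is defined. *)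

theory Defs
  imports "HOL-Analysis.Analysis"
begin

type_synonym pt = "real \<times> real"

definition ellipse :: "real \<Rightarrow> real \<Rightarrow> pt set" where
  "ellipse a b = {(x, y). x\<^sup>2 / a\<^sup>2 + y\<^sup>2 / b\<^sup>2 = 1}"

definition cross2 :: "pt \<Rightarrow> pt \<Rightarrow> real" where
  "cross2 u v = fst u * snd v - snd u * fst v"

text \<open>Normal direction to the ellipse at a point (gradient of x^2/a^2 + y^2/b^2, up to factor 2).\<close>
definition ell_normal :: "real \<Rightarrow> real \<Rightarrow> pt \<Rightarrow> pt" where
  "ell_normal a b P = (fst P / a\<^sup>2, snd P / b\<^sup>2)"

text \<open>The normal line at P (through P, direction ell_normal) contains the internal
  bisector of the angle QPR, whose direction is the sum of the unit vectors towards Q and R.\<close>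
definition normal_bisects :: "real \<Rightarrow> real \<Rightarrow> pt \<Rightarrow> pt \<Rightarrow> pt \<Rightarrow> bool" where
  "normal_bisects a b P Q R \<longleftrightarrow>
     cross2 ((1 / dist Q P) *\<^sub>R (Q - P) + (1 / dist R P) *\<^sub>R (R - P)) (ell_normal a b P) = 0"

definition nondegenerate :: "pt \<Rightarrow> pt \<Rightarrow> pt \<Rightarrow> bool" where
  "nondegenerate P1 P2 P3 \<longleftrightarrow> cross2 (P2 - P1) (P3 - P1) \<noteq> 0"

definition three_periodic :: "real \<Rightarrow> real \<Rightarrow> pt \<times> pt \<times> pt \<Rightarrow> bool" where
  "three_periodic a b T = (case T of (P1, P2, P3) \<Rightarrow>
     nondegenerate P1 P2 P3 \<and>
     P1 \<in> ellipse a b \<and> P2 \<in> ellipse a b \<and> P3 \<in> ellipse a b \<and>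
     normal_bisects a b P1 P2 P3 \<and> normal_bisects a b P2 P3 P1 \<and> normal_bisects a b P3 P1 P2)"

type_synonym center_fun = "real \<Rightarrow> real \<Rightarrow> real \<Rightarrow> real option"

definition center_defined :: "center_fun \<Rightarrow> pt \<times> pt \<times> pt \<Rightarrow> bool" where
  "center_defined h T = (case T of (P1, P2, P3) \<Rightarrow>
     let s1 = dist P2 P3; s2 = dist P3 P1; s3 = dist P1 P2 in
     h s1 s2 s3 \<noteq> None \<and> h s2 s3 s1 \<noteq> None \<and> h s3 s1 s2 \<noteq> None \<and>
     the (h s1 s2 s3) * s1 + the (h s2 s3 s1) * s2 + the (h s3 s1 s2) * s3 \<noteq> 0)"

definition center :: "center_fun \<Rightarrow> pt \<times> pt \<times> pt \<Rightarrow> pt" where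
  "center h T = (case T of (P1, P2, P3) \<Rightarrow>
     let s1 = dist P2 P3; s2 = dist P3 P1; s3 = dist P1 P2;
         p = the (h s1 s2 s3); q = the (h s2 s3 s1); r = the (h s3 s1 s2) in
     (1 / (p * s1 + q * s2 + r * s3)) *\<^sub>R ((p * s1) *\<^sub>R P1 + (q * s2) *\<^sub>R P2 + (r * s3) *\<^sub>R P3))"

definition locus :: "real \<Rightarrow> real \<Rightarrow> center_fun \<Rightarrow> pt set" where
  "locus a b h = {center h T | T. three_periodic a b T \<and> center_defined h T}"

definition h88 :: center_fun where
  "h88 s1 s2 s3 = (if s2 + s3 - 2 * s1 = 0 then None else Some (1 / (s2 + s3 - 2 * s1)))"

definition h100 :: center_fun where
  "h100 s1 s2 s3 = (if s2 - s3 = 0 then None else Some (1 / (s2 - s3)))"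

end

theory Submission
  imports Defs "HOL-Computational_Algebra.Fundamental_Theorem_Algebra"
begin

text \<open>
  By Joachimsthal's integral, the polarised form of the ellipse satisfies
  \<open>1 - B(P\<^sub>i, P\<^sub>j) = J |P\<^sub>i P\<^sub>j|\<close> on a 3-periodic. Hence in trilinears the ellipse is
  \<open>1/\<alpha> + 1/\<beta> + 1/\<gamma> = 0\<close>, and both centers satisfy this identically.

  For the density, map the ellipse affinely to the unit circle. There the triangles with
  \<open>z\<^sub>1 z\<^sub>2 z\<^sub>3 = l\<close>, \<open>z\<^sub>1 z\<^sub>2 + z\<^sub>2 z\<^sub>3 + z\<^sub>3 z\<^sub>1 = - k\<close> and
  \<open>z\<^sub>1 + z\<^sub>2 + z\<^sub>3 = - k l\<close> are 3-periodics for one value of \<open>k\<close> in \<open>(0, 1)\<close> and every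
  unit \<open>l\<close>, with side lengths proportional to \<open>|z\<^sub>i - z\<^sub>j|\<^sup>2\<close>. A point \<open>w\<close> of the circle then
  is the center with trilinears \<open>1/d\<^sub>i\<close> iff \<open>d\<^sub>1 : d\<^sub>2 : d\<^sub>3\<close> is
  \<open>(w - z\<^sub>1) (z\<^sub>2 - z\<^sub>3) : (w - z\<^sub>2) (z\<^sub>3 - z\<^sub>1) : (w - z\<^sub>3) (z\<^sub>1 - z\<^sub>2)\<close>.
  This gives \<open>w = 1 / l\<close> for \<open>X\<^sub>1\<^sub>0\<^sub>0\<close>, and for \<open>X\<^sub>8\<^sub>8\<close>
  \<open>w = - l (9 + k\<^sup>2 + 6 k l\<^sup>2) / ((9 + k\<^sup>2) l\<^sup>2 + 6 k)\<close>. Both equations have a unit solution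
  \<open>l\<close> for each unit \<open>w\<close>, and the center is undefined only if \<open>w\<close> is a vertex, which
  happens for finitely many \<open>w\<close>.
\<close>

section \<open>Polar form of the ellipse and the bisector condition\<close>

definition ell_form :: "real \<Rightarrow> real \<Rightarrow> pt \<Rightarrow> pt \<Rightarrow> real" where
  "ell_form a b P Q = fst P * fst Q / a\<^sup>2 + snd P * snd Q / b\<^sup>2"

lemma mem_ellipse_iff: "P \<in> ellipse a b \<longleftrightarrow> ell_form a b P P = 1"
  by (cases P) (simp add: ellipse_def ell_form_def power2_eq_square)

lemma ell_form_commute: "ell_form a b P Q = ell_form a b Q P"
  by (simp add: ell_form_def mult.commute)

text \<open>For unit vectors, \<open>u + v\<close> is orthogonal to \<open>u - v\<close>, so the
  cross product of \<open>u + v\<close> with \<open>n\<close> is a multiple of the inner product of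
  \<open>u - v\<close> with \<open>n\<close>. The factors are 1 + cos and sin of the angle between
  them.\<close>

lemma unit_bisector_identity:
  fixes u1 u2 v1 v2 n1 n2 :: real
  assumes u: "u1\<^sup>2 + u2\<^sup>2 = 1" and v: "v1\<^sup>2 + v2\<^sup>2 = 1"
  shows "(1 + (u1 * v1 + u2 * v2)) * ((u1 - v1) * n1 + (u2 - v2) * n2) =
         - ((u1 * v2 - u2 * v1) * ((u1 + v1) * n2 - (u2 + v2) * n1))"
  using u v by algebra

text \<open>The normal bisects the angle iff both unit vectors along the sides have the same inner
  product with the normal \<open>n\<close>. As \<open>P\<close> is on the ellipse, the inner product
  of \<open>n\<close> with \<open>Q - P\<close> is \<open>ell_form a b P Q - 1\<close>.\<close>

lemma normal_bisects_iff:
  assumes nd: "nondegenerate P Q R" and P: "P \<in> ellipse a b"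
  shows "normal_bisects a b P Q R \<longleftrightarrow>
    (1 - ell_form a b P Q) * dist R P = (1 - ell_form a b P R) * dist Q P"
proof -
  obtain x y where Pxy: "P = (x, y)" by (cases P)
  obtain x1 y1 where Qxy: "Q = (x1, y1)" by (cases Q)
  obtain x2 y2 where Rxy: "R = (x2, y2)" by (cases R)
  define d e where "d = dist Q P" and "e = dist R P"
  have cr: "(x1 - x) * (y2 - y) - (y1 - y) * (x2 - x) \<noteq> 0"
    using nd by (simp add: nondegenerate_def cross2_def Pxy Qxy Rxy)
  have de: "d > 0" "e > 0"
    using cr by (auto simp: d_def e_def Pxy Qxy Rxy)
  have d2: "(x1 - x)\<^sup>2 + (y1 - y)\<^sup>2 = d\<^sup>2" and e2: "(x2 - x)\<^sup>2 + (y2 - y)\<^sup>2 = e\<^sup>2"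
    by (simp_all add: d_def e_def Pxy Qxy Rxy dist_Pair_Pair dist_real_def)
  define u1 u2 v1 v2 where "u1 = (x1 - x) / d" and "u2 = (y1 - y) / d"
    and "v1 = (x2 - x) / e" and "v2 = (y2 - y) / e"
  define n1 n2 where "n1 = x / a\<^sup>2" and "n2 = y / b\<^sup>2"
  have u: "u1\<^sup>2 + u2\<^sup>2 = 1" and v: "v1\<^sup>2 + v2\<^sup>2 = 1"
    using de by (simp_all add: u1_def u2_def v1_def v2_def power_divide d2 e2 flip: add_divide_distrib)
  have uv: "u1 * v2 - u2 * v1 \<noteq> 0"
  proof -
    have "u1 * v2 - u2 * v1 = ((x1 - x) * (y2 - y) - (y1 - y) * (x2 - x)) / (d * e)"
      using de by (simp add: u1_def u2_def v1_def v2_def field_simps)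
    then show ?thesis using cr de by simp
  qed
  \<comment> \<open>This is (1 + cos)(1 - cos) = sin^2; non-degeneracy excludes opposite
    directions.\<close>
  have "(1 + (u1 * v1 + u2 * v2)) * (1 - (u1 * v1 + u2 * v2)) = (u1 * v2 - u2 * v1)\<^sup>2"
    using u v by algebra
  with uv have pos: "1 + (u1 * v1 + u2 * v2) \<noteq> 0"
    by force
  have "normal_bisects a b P Q R \<longleftrightarrow> (u1 + v1) * n2 - (u2 + v2) * n1 = 0"
    by (simp add: normal_bisects_def cross2_def ell_normal_def Pxy Qxy Rxy
        u1_def u2_def v1_def v2_def n1_def n2_def d_def e_def)
  also have "\<dots> \<longleftrightarrow> (u1 - v1) * n1 + (u2 - v2) * n2 = 0"
    using unit_bisector_identity[OF u v, of n1 n2] pos uv by (metis mult_eq_0_iff neg_equal_0_iff_equal)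
  also have "(u1 - v1) * n1 + (u2 - v2) * n2 = (ell_form a b P Q - 1) / d - (ell_form a b P R - 1) / e"
  proof -
    have "x * n1 + y * n2 = 1"
      using P by (simp add: mem_ellipse_iff ell_form_def Pxy n1_def n2_def)
    moreover have "ell_form a b P Q = x1 * n1 + y1 * n2" "ell_form a b P R = x2 * n1 + y2 * n2"
      by (simp_all add: ell_form_def Pxy Qxy Rxy n1_def n2_def mult.commute)
    ultimately have *: "ell_form a b P Q - 1 = (x1 - x) * n1 + (y1 - y) * n2"
      "ell_form a b P R - 1 = (x2 - x) * n1 + (y2 - y) * n2"
      by (simp_all add: left_diff_distrib)
    show ?thesis
      unfolding * using de by (simp add: u1_def u2_def v1_def v2_def field_simps)
  qed
  also have "\<dots> = 0 \<longleftrightarrow> (1 - ell_form a b P Q) * e = (1 - ell_form a b P R) * d"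
    using de by (auto simp: field_simps)
  finally show ?thesis by (simp add: d_def e_def)
qed

lemma nondegenerate_rotate: "nondegenerate P Q R \<longleftrightarrow> nondegenerate Q R P"
  by (simp add: nondegenerate_def cross2_def algebra_simps)

lemma nondegenerate_distinct:
  assumes "nondegenerate P Q R"
  shows "P \<noteq> Q" "Q \<noteq> R" "R \<noteq> P"
  using assms by (auto simp: nondegenerate_def cross2_def)

text \<open>The constant \<open>J\<close> is Joachimsthal's integral of the billiard.\<close>

lemma three_periodic_iff:
  "three_periodic a b (P1, P2, P3) \<longleftrightarrow> nondegenerate P1 P2 P3 \<and>
     P1 \<in> ellipse a b \<and> P2 \<in> ellipse a b \<and> P3 \<in> ellipse a b \<and>
     (\<exists>J. 1 - ell_form a b P2 P3 = J * dist P2 P3 \<and> 1 - ell_form a b P3 P1 = J * dist P3 P1 \<and>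
          1 - ell_form a b P1 P2 = J * dist P1 P2)"
proof (cases "nondegenerate P1 P2 P3 \<and> P1 \<in> ellipse a b \<and> P2 \<in> ellipse a b \<and> P3 \<in> ellipse a b")
  case False
  then show ?thesis by (auto simp: three_periodic_def)
next
  case True
  then have nd: "nondegenerate P1 P2 P3" "nondegenerate P2 P3 P1" "nondegenerate P3 P1 P2"
    by (simp_all add: nondegenerate_rotate[of P1] nondegenerate_rotate[of P3])
  define s1 s2 s3 where "s1 = dist P2 P3" and "s2 = dist P3 P1" and "s3 = dist P1 P2"
  define t1 t2 t3 where "t1 = 1 - ell_form a b P2 P3" and "t2 = 1 - ell_form a b P3 P1"
    and "t3 = 1 - ell_form a b P1 P2"
  have s: "s1 > 0" "s2 > 0" "s3 > 0"
    using nondegenerate_distinct[OF nd(1)] by (auto simp: s1_def s2_def s3_def)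
  \<comment> \<open>Bisection at a vertex equates the ratios \<open>t / s\<close> of the two sides
    through it; together the three conditions give one common ratio \<open>J\<close>.\<close>
  have "three_periodic a b (P1, P2, P3) \<longleftrightarrow>
      t3 * s2 = t2 * s3 \<and> t1 * s3 = t3 * s1 \<and> t2 * s1 = t1 * s2"
    using True nd
    by (simp add: three_periodic_def normal_bisects_iff s1_def s2_def s3_def t1_def t2_def t3_def
        dist_commute ell_form_commute)
  also have "\<dots> \<longleftrightarrow> (\<exists>J. t1 = J * s1 \<and> t2 = J * s2 \<and> t3 = J * s3)"
  proof
    assume *: "t3 * s2 = t2 * s3 \<and> t1 * s3 = t3 * s1 \<and> t2 * s1 = t1 * s2"
    then have "t1 = (t1 / s1) * s1 \<and> t2 = (t1 / s1) * s2 \<and> t3 = (t1 / s1) * s3"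
      using s by (auto simp: field_simps)
    then show "\<exists>J. t1 = J * s1 \<and> t2 = J * s2 \<and> t3 = J * s3" by blast
  qed (auto simp: mult_ac)
  finally show ?thesis using True by (simp add: s1_def s2_def s3_def t1_def t2_def t3_def)
qed

section \<open>Centers with reciprocal trilinears lie on the ellipse\<close>

text \<open>Normalised barycentric coordinates; trilinears \<open>1 / d\<close> have barycentric
  weights \<open>s / d\<close>.\<close>

definition weighted_point :: "real \<Rightarrow> real \<Rightarrow> real \<Rightarrow> pt \<Rightarrow> pt \<Rightarrow> pt \<Rightarrow> pt" where
  "weighted_point p q r P Q R = (1 / (p + q + r)) *\<^sub>R (p *\<^sub>R P + q *\<^sub>R Q + r *\<^sub>R R)"

text \<open>Expand \<open>(p + q + r)\<^sup>2\<close> minus the quadratic form of the unnormalised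
  sum: the squares cancel because the form is 1 at the vertices, and only the mixed terms
  remain.\<close>

lemma ell_form_weighted_point:
  assumes "P \<in> ellipse a b" "Q \<in> ellipse a b" "R \<in> ellipse a b" and "p + q + r \<noteq> 0"
  shows "(p + q + r)\<^sup>2 * (1 - ell_form a b (weighted_point p q r P Q R) (weighted_point p q r P Q R)) =
    2 * (q * r * (1 - ell_form a b Q R) + r * p * (1 - ell_form a b R P) + p * q * (1 - ell_form a b P Q))"
proof -
  define A B where "A = 1 / a\<^sup>2" and "B = 1 / b\<^sup>2"
  have form: "ell_form a b X Y = A * (fst X * fst Y) + B * (snd X * snd Y)" for X Y
    by (simp add: ell_form_def A_def B_def)
  define X where "X = p *\<^sub>R P + q *\<^sub>R Q + r *\<^sub>R R"
  have scale: "ell_form a b (c *\<^sub>R X) (c *\<^sub>R X) = c\<^sup>2 * ell_form a b X X" for c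
    by (simp add: form power2_eq_square algebra_simps)
  have PQR: "ell_form a b P P = 1" "ell_form a b Q Q = 1" "ell_form a b R R = 1"
    using assms by (simp_all add: mem_ellipse_iff)
  have "ell_form a b X X = p\<^sup>2 * ell_form a b P P + q\<^sup>2 * ell_form a b Q Q + r\<^sup>2 * ell_form a b R R
      + 2 * (q * r * ell_form a b Q R + r * p * ell_form a b R P + p * q * ell_form a b P Q)"
    by (simp add: X_def form power2_eq_square algebra_simps)
  then show ?thesis
    using assms(4) unfolding weighted_point_def X_def[symmetric] scale PQR
    by (simp add: right_diff_distrib power_divide) (simp add: power2_eq_square algebra_simps)
qed

text \<open>In trilinears \<open>\<alpha> : \<beta> : \<gamma>\<close> the ellipse has the equation
  \<open>\<beta>\<gamma> + \<gamma>\<alpha> + \<alpha>\<beta> = 0\<close>, by \<open>three_periodic_iff\<close>.\<close>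

lemma weighted_point_mem_ellipse:
  assumes T: "three_periodic a b (P1, P2, P3)"
    and s: "s1 = dist P2 P3" "s2 = dist P3 P1" "s3 = dist P1 P2"
    and d: "d1 \<noteq> 0" "d2 \<noteq> 0" "d3 \<noteq> 0" "d1 + d2 + d3 = 0"
    and nz: "s1 / d1 + s2 / d2 + s3 / d3 \<noteq> 0"
  shows "weighted_point (s1 / d1) (s2 / d2) (s3 / d3) P1 P2 P3 \<in> ellipse a b"
proof -
  obtain J where J: "1 - ell_form a b P2 P3 = J * s1" "1 - ell_form a b P3 P1 = J * s2"
      "1 - ell_form a b P1 P2 = J * s3"
    and E: "P1 \<in> ellipse a b" "P2 \<in> ellipse a b" "P3 \<in> ellipse a b"
    using T by (auto simp: three_periodic_iff s)
  \<comment> \<open>Every term contains \<open>J * s1 * s2 * s3\<close>, so only the cyclic sum of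
    \<open>1 / (d2 * d3)\<close> matters.\<close>
  have "s2 / d2 * (s3 / d3) * (J * s1) + s3 / d3 * (s1 / d1) * (J * s2) + s1 / d1 * (s2 / d2) * (J * s3)
      = J * s1 * s2 * s3 * (d1 + d2 + d3) / (d1 * d2 * d3)"
    using d(1-3) by (simp add: field_simps)
  also have "\<dots> = 0" by (simp add: d)
  finally show ?thesis
    using ell_form_weighted_point[OF E nz] nz by (simp add: J mem_ellipse_iff)
qed

lemma center_eq_weighted_point:
  assumes "s1 = dist P2 P3" "s2 = dist P3 P1" "s3 = dist P1 P2"
    and "h s1 s2 s3 = Some (1 / d1)" "h s2 s3 s1 = Some (1 / d2)" "h s3 s1 s2 = Some (1 / d3)"
  shows "center_defined h (P1, P2, P3) \<longleftrightarrow> s1 / d1 + s2 / d2 + s3 / d3 \<noteq> 0"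
    and "center h (P1, P2, P3) = weighted_point (s1 / d1) (s2 / d2) (s3 / d3) P1 P2 P3"
  using assms by (simp_all add: center_defined_def center_def weighted_point_def Let_def)

definition reciprocal_center :: "(real \<Rightarrow> real \<Rightarrow> real \<Rightarrow> real) \<Rightarrow> center_fun" where
  "reciprocal_center f s1 s2 s3 = (if f s1 s2 s3 = 0 then None else Some (1 / f s1 s2 s3))"

lemma h88_eq: "h88 = reciprocal_center (\<lambda>s1 s2 s3. s2 + s3 - 2 * s1)"
  by (simp add: fun_eq_iff h88_def reciprocal_center_def)

lemma h100_eq: "h100 = reciprocal_center (\<lambda>s1 s2 s3. s2 - s3)"
  by (simp add: fun_eq_iff h100_def reciprocal_center_def)

text \<open>For reciprocal trilinears the ellipse equation is linear in the denominators: their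
  cyclic sum vanishes. This holds identically for both centers.\<close>

lemma reciprocal_center_mem_ellipse:
  assumes f: "\<And>s1 s2 s3. f s1 s2 s3 + f s2 s3 s1 + f s3 s1 s2 = 0"
    and T: "three_periodic a b T" and def: "center_defined (reciprocal_center f) T"
  shows "center (reciprocal_center f) T \<in> ellipse a b"
proof -
  obtain P1 P2 P3 where Teq: "T = (P1, P2, P3)" by (cases T)
  define s1 s2 s3 where s: "s1 = dist P2 P3" "s2 = dist P3 P1" "s3 = dist P1 P2"
  have nz: "f s1 s2 s3 \<noteq> 0" "f s2 s3 s1 \<noteq> 0" "f s3 s1 s2 \<noteq> 0"
    using def by (auto simp: Teq center_defined_def reciprocal_center_def s Let_def split: if_splits)
  have h: "reciprocal_center f s1 s2 s3 = Some (1 / f s1 s2 s3)"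
    "reciprocal_center f s2 s3 s1 = Some (1 / f s2 s3 s1)"
    "reciprocal_center f s3 s1 s2 = Some (1 / f s3 s1 s2)"
    using nz by (simp_all add: reciprocal_center_def)
  show ?thesis
    using weighted_point_mem_ellipse[OF T[unfolded Teq] s nz f]
      def[unfolded Teq center_eq_weighted_point(1)[where h = "reciprocal_center f", OF s h]]
    by (simp add: Teq center_eq_weighted_point(2)[where h = "reciprocal_center f", OF s h])
qed

section \<open>Transfer to the unit circle and density\<close>

definition stretch :: "real \<Rightarrow> real \<Rightarrow> complex \<Rightarrow> pt" where
  "stretch a b z = (a * Re z, b * Im z)"

lemma ell_form_stretch:
  assumes "a \<noteq> 0" "b \<noteq> 0"
  shows "ell_form a b (stretch a b z) (stretch a b w) = Re z * Re w + Im z * Im w"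
  using assms by (simp add: ell_form_def stretch_def power2_eq_square)

lemma ellipse_eq_stretch:
  assumes "a \<noteq> 0" "b \<noteq> 0"
  shows "ellipse a b = stretch a b ` sphere 0 1"
proof -
  have "P \<in> stretch a b ` sphere 0 1" if "P \<in> ellipse a b" for P
  proof
    show "P = stretch a b (Complex (fst P / a) (snd P / b))"
      using assms by (simp add: stretch_def)
    show "Complex (fst P / a) (snd P / b) \<in> sphere 0 1"
      using that by (cases P) (simp add: ellipse_def cmod_def power_divide)
  qed
  moreover have "stretch a b z \<in> ellipse a b" if "cmod z = 1" for z
    using that assms by (simp add: mem_ellipse_iff ell_form_stretch cmod_def power2_eq_square)
  ultimately show ?thesis by auto
qed

lemma continuous_on_stretch: "continuous_on S (stretch a b)"
  unfolding stretch_def by (intro continuous_intros)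

text \<open>The circle is connected with more than one point, hence has no isolated points; removing
  finitely many leaves a dense subset, and \<open>stretch\<close> is continuous.\<close>

lemma ellipse_subset_closure:
  assumes "a \<noteq> 0" "b \<noteq> 0" and F: "finite F"
    and L: "\<And>w. cmod w = 1 \<Longrightarrow> w \<notin> F \<Longrightarrow> stretch a b w \<in> L"
  shows "ellipse a b \<subseteq> closure L"
proof -
  have "sphere 0 1 \<subseteq> closure (sphere 0 1 - F :: complex set)"
  proof
    fix x :: complex assume x: "x \<in> sphere 0 1"
    have "- x \<in> sphere 0 1" "- x \<noteq> x"
      using x by auto
    then have "(sphere 0 1 :: complex set) \<noteq> {y}" for y
      using x by (metis singletonD)
    moreover have "connected (sphere 0 1 :: complex set)"
      by (rule connected_sphere) simp
    ultimately have "x islimpt sphere 0 1"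
      using x by (intro connected_imp_perfect) blast+
    then have "x islimpt (F \<union> (sphere 0 1 - F))"
      by (rule islimpt_subset) auto
    then show "x \<in> closure (sphere 0 1 - F)"
      unfolding islimpt_Un_finite[OF F] closure_def by blast
  qed
  then have "ellipse a b \<subseteq> stretch a b ` closure (sphere 0 1 - F)"
    using assms by (auto simp: ellipse_eq_stretch)
  also have "\<dots> \<subseteq> closure L"
  proof (rule image_closure_subset[OF continuous_on_stretch closed_closure])
    have "stretch a b ` (sphere 0 1 - F) \<subseteq> L"
      using L by auto
    then show "stretch a b ` (sphere 0 1 - F) \<subseteq> closure L"
      using closure_subset by blast
  qed
  finally show ?thesis .
qed

section \<open>Blaschke triples on the circle\<close>

text \<open>This choice of \<open>k\<close> makes the factor in \<open>dist_stretch_unit\<close>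
  proportional to the squared chord in \<open>blaschke_triple_chord\<close>. It exists by the
  intermediate value theorem on [0, 1].\<close>

lemma exists_caustic_parameter:
  fixes a b :: real
  assumes "a > b" "b > 0"
  shows "\<exists>k. 0 < k \<and> k < 1 \<and> (3 - k\<^sup>2) * (a\<^sup>2 - b\<^sup>2) = 2 * k * (a\<^sup>2 + b\<^sup>2)"
proof -
  define g where "g k = 2 * k * (a\<^sup>2 + b\<^sup>2) - (3 - k\<^sup>2) * (a\<^sup>2 - b\<^sup>2)" for k
  have sq: "b\<^sup>2 < a\<^sup>2" "0 < b\<^sup>2"
    using assms by (auto intro: power_strict_mono)
  have g0: "g 0 < 0" and g1: "g 1 > 0"
    using sq by (simp_all add: g_def)
  have "\<exists>k\<ge>0. k \<le> 1 \<and> g k = 0"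
    using g0 g1 unfolding g_def by (intro IVT') (auto intro!: continuous_intros)
  then obtain k where k: "0 \<le> k" "k \<le> 1" "g k = 0" by blast
  with g0 g1 have "k \<noteq> 0" "k \<noteq> 1" by auto
  with k show ?thesis by (intro exI[of _ k]) (auto simp: g_def)
qed

text \<open>The equation is \<open>z * (w - k) = l * (1 - k * w)\<close> with
  \<open>w = z\<^sup>2\<close>. The sign of \<open>B\<^sup>2 - A\<^sup>2\<close> is that of
  \<open>1 - cmod z\<close>, while \<open>cmod z * A = B\<close> forces the opposite sign off the
  circle.\<close>

lemma blaschke_root_norm:
  fixes z l :: complex and k :: real
  assumes k: "0 \<le> k" "k < 1" and l: "cmod l = 1"
    and z: "z ^ 3 + of_real k * l * z\<^sup>2 - of_real k * z - l = 0"
  shows "cmod z = 1"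
proof -
  define w where "w = z\<^sup>2"
  define A B where "A = cmod (w - of_real k)" and "B = cmod (1 - of_real k * w)"
  have "z * (w - of_real k) = l * (1 - of_real k * w)"
    using z by (simp add: w_def algebra_simps power2_eq_square power3_eq_cube)
  then have eq: "cmod z * A = B"
    using l by (metis A_def B_def mult_1 norm_mult)
  have "B\<^sup>2 - A\<^sup>2 = (1 - k\<^sup>2) * (1 - (cmod w)\<^sup>2)"
    unfolding A_def B_def cmod_power2 by (simp add: power2_eq_square algebra_simps)
  then have id: "B\<^sup>2 - A\<^sup>2 = (1 - k\<^sup>2) * (1 - cmod z ^ 4)"
    by (simp add: w_def norm_power flip: power_mult)
  have k2: "1 - k\<^sup>2 > 0"
    using k by (simp add: power_less_one_iff)
  have A: "A \<ge> 0" by (simp add: A_def)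
  show ?thesis
  proof (rule linorder_cases[of "cmod z" 1])
    assume lt: "cmod z < 1"
    then have "cmod z ^ 4 < 1" by (simp add: power_less_one_iff)
    with k2 have "0 < B\<^sup>2 - A\<^sup>2" unfolding id by simp
    moreover have "cmod z * A \<le> 1 * A" using A lt by (intro mult_right_mono) simp_all
    then have "B\<^sup>2 \<le> A\<^sup>2" unfolding eq by (intro power_mono) (simp_all add: B_def)
    ultimately show ?thesis by simp
  next
    assume gt: "cmod z > 1"
    then have "cmod z ^ 4 > 1" by simp
    with k2 have "B\<^sup>2 - A\<^sup>2 < 0" unfolding id by (intro mult_pos_neg) simp_all
    moreover have "1 * A \<le> cmod z * A" using A gt by (intro mult_right_mono) simp_all
    then have "A\<^sup>2 \<le> B\<^sup>2" unfolding eq using A by (intro power_mono) simp_all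
    ultimately show ?thesis by simp
  qed
qed

text \<open>The solutions of \<open>z (z\<^sup>2 - k) / (1 - k z\<^sup>2) = l\<close>, a Blaschke product of degree 3:
  as \<open>l\<close> runs over the unit circle, they form the Poncelet triangles inscribed in
  the circle and circumscribed about an ellipse with foci \<open>\<plusminus>\<surd>k\<close>.\<close>

definition blaschke_triple :: "real \<Rightarrow> complex \<Rightarrow> complex \<Rightarrow> complex \<Rightarrow> complex \<Rightarrow> bool" where
  "blaschke_triple k l z1 z2 z3 \<longleftrightarrow> cmod z1 = 1 \<and> cmod z2 = 1 \<and> cmod z3 = 1 \<and>
     z1 + z2 + z3 = - (of_real k * l) \<and> z1 * z2 + z2 * z3 + z3 * z1 = - of_real k \<and> z1 * z2 * z3 = l"

lemma blaschke_triple_rotate: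
  assumes "blaschke_triple k l z1 z2 z3"
  shows "blaschke_triple k l z2 z3 z1"
  using assms by (simp add: blaschke_triple_def add_ac mult_ac)

lemma cubic_from_roots:
  fixes w z1 z2 z3 :: "'a::comm_ring_1"
  shows "(w - z1) * (w - z2) * (w - z3) =
    w ^ 3 - (z1 + z2 + z3) * w\<^sup>2 + (z1 * z2 + z2 * z3 + z3 * z1) * w - z1 * z2 * z3"
  by (simp add: algebra_simps power2_eq_square power3_eq_cube)

lemma blaschke_triple_prod:
  assumes "blaschke_triple k l z1 z2 z3"
  shows "(w - z1) * (w - z2) * (w - z3) = w ^ 3 + of_real k * l * w\<^sup>2 - of_real k * w - l"
  using assms unfolding cubic_from_roots by (simp add: blaschke_triple_def)

text \<open>The fundamental theorem of algebra gives \<open>z1\<close>; the other two roots solve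
  the quadratic with sum \<open>s\<close> and product \<open>l / z1\<close>, and the middle
  coefficient follows from \<open>P z1 = 0\<close>.\<close>

lemma blaschke_triple_exists:
  assumes k: "0 \<le> k" "k < 1" and l: "cmod l = 1"
  shows "\<exists>z1 z2 z3. blaschke_triple k l z1 z2 z3"
proof -
  define P where "P w = w ^ 3 + of_real k * l * w\<^sup>2 - of_real k * w - l" for w
  have "\<not> constant (poly [:- l, - of_real k, of_real k * l, 1:])"
    by (simp add: constant_degree)
  then obtain z1 where "poly [:- l, - of_real k, of_real k * l, 1:] z1 = 0"
    using fundamental_theorem_of_algebra by blast
  then have z1: "P z1 = 0"
    by (simp add: P_def algebra_simps power2_eq_square power3_eq_cube)
  then have n1: "cmod z1 = 1"
    using blaschke_root_norm[OF k l] by (simp add: P_def)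
  then have nz: "z1 \<noteq> 0" by auto
  define s where "s = - (of_real k * l) - z1"
  define r where "r = csqrt (s\<^sup>2 - 4 * (l / z1))"
  define z2 z3 where "z2 = (s + r) / 2" and "z3 = (s - r) / 2"
  have sum: "z2 + z3 = s" by (simp add: z2_def z3_def field_simps)
  have "z2 * z3 = (s\<^sup>2 - r\<^sup>2) / 4"
    by (simp add: z2_def z3_def power2_eq_square algebra_simps)
  also have "\<dots> = l / z1" by (simp add: r_def)
  finally have "z2 * z3 = l / z1" .
  then have prod: "z1 * (z2 * z3) = l" using nz by simp
  have "z1 * (z1 * (z2 + z3) + z2 * z3 + of_real k) = 0"
    using z1 unfolding sum distrib_left prod
    by (simp add: s_def P_def algebra_simps power2_eq_square power3_eq_cube)
  then have e2: "z1 * (z2 + z3) + z2 * z3 = - of_real k"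
    using nz by (simp add: add_eq_0_iff2)
  have e: "z1 + z2 + z3 = - (of_real k * l)" "z1 * z2 + z2 * z3 + z3 * z1 = - of_real k" "z1 * z2 * z3 = l"
    using sum prod e2 by (simp_all add: s_def algebra_simps)
  have "P w = (w - z1) * (w - z2) * (w - z3)" for w
    unfolding cubic_from_roots e P_def by simp
  then have "P z2 = 0" "P z3 = 0" by simp_all
  then have "cmod z2 = 1" "cmod z3 = 1"
    using blaschke_root_norm[OF k l] by (simp_all add: P_def)
  with n1 e show ?thesis by (auto simp: blaschke_triple_def)
qed

text \<open>Conjugation inverts unit numbers, so squared chords become rational in their
  endpoints.\<close>

lemma unit_diff_norm:
  fixes z w :: complex
  assumes "cmod z = 1" "cmod w = 1"
  shows "of_real ((cmod (z - w))\<^sup>2) = - ((z - w)\<^sup>2 / (z * w))"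
proof -
  have nz: "z \<noteq> 0" "w \<noteq> 0" using assms by auto
  have "cnj z = 1 / z" "cnj w = 1 / w"
    using assms by (simp_all add: divide_conv_cnj)
  then have "of_real ((cmod (z - w))\<^sup>2) = (z - w) * (1 / z - 1 / w)"
    by (simp only: complex_norm_square complex_cnj_diff)
  also have "\<dots> = - ((z - w)\<^sup>2 / (z * w))"
    using nz by (simp add: field_simps power2_eq_square)
  finally show ?thesis .
qed

text \<open>Eliminating the third vertex leaves a chord length that depends only on the product of
  the endpoints.\<close>

lemma blaschke_triple_chord:
  assumes "blaschke_triple k l z1 z2 z3"
  shows "(cmod (z1 - z2))\<^sup>2 = 3 - k\<^sup>2 - 2 * k * Re (z1 * z2)"
proof -
  define p where "p = z1 * z2"
  have u: "cmod z1 = 1" "cmod z2 = 1" "cmod p = 1"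
    using assms by (auto simp: blaschke_triple_def p_def norm_mult)
  have nz: "p \<noteq> 0" using u by auto
  have e: "z1 + z2 + z3 = - (of_real k * l)" "z1 * z2 + z2 * z3 + z3 * z1 = - of_real k" "z1 * z2 * z3 = l"
    using assms by (auto simp: blaschke_triple_def)
  \<comment> \<open>With \<open>s = z1 + z2\<close>, the relations give
    \<open>s * z3 = - k - p\<close> and \<open>s = - z3 * (1 + k * p)\<close>, so
    \<open>s\<^sup>2 = (k + p) * (1 + k * p)\<close>; subtract \<open>4 * p\<close>.\<close>
  have "(z1 - z2)\<^sup>2 = of_real k * p\<^sup>2 + of_real k - (3 - (of_real k)\<^sup>2) * p"
    using e unfolding p_def by algebra
  then have "- ((z1 - z2)\<^sup>2 / p) = - ((of_real k * p\<^sup>2 + of_real k - (3 - (of_real k)\<^sup>2) * p) / p)"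
    by simp
  also have "\<dots> = 3 - (of_real k)\<^sup>2 - of_real k * (p + 1 / p)"
    using nz by (simp add: field_simps power2_eq_square)
  also have "1 / p = cnj p" using u by (simp add: divide_conv_cnj)
  also have "p + cnj p = of_real (2 * Re p)" by (simp add: complex_add_cnj)
  also have "3 - (of_real k)\<^sup>2 - of_real k * of_real (2 * Re p) = (of_real (3 - k\<^sup>2 - 2 * k * Re p) :: complex)"
    by simp
  finally have "of_real ((cmod (z1 - z2))\<^sup>2) = (of_real (3 - k\<^sup>2 - 2 * k * Re p) :: complex)"
    unfolding unit_diff_norm[OF u(1,2)] p_def .
  then show ?thesis unfolding of_real_eq_iff p_def .
qed

text \<open>The squared chord is at least
  \<open>3 - k\<^sup>2 - 2 * k = (3 + k) * (1 - k) > 0\<close>.\<close>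

lemma blaschke_triple_distinct:
  assumes k: "0 \<le> k" "k < 1" and T: "blaschke_triple k l z1 z2 z3"
  shows "z1 \<noteq> z2"
proof
  assume "z1 = z2"
  then have "3 - k\<^sup>2 = 2 * k * Re (z1 * z2)"
    using blaschke_triple_chord[OF T] by simp
  moreover have "cmod (z1 * z2) = 1"
    using T by (simp add: blaschke_triple_def norm_mult)
  then have "Re (z1 * z2) \<le> 1"
    using complex_Re_le_cmod[of "z1 * z2"] by simp
  then have "2 * k * Re (z1 * z2) \<le> 2 * k"
    using k mult_left_mono[of _ 1 "2 * k"] by simp
  moreover have "(3 + k) * (1 - k) > 0" using k by simp
  ultimately show False by (simp add: power2_eq_square algebra_simps)
qed

section \<open>Side lengths and barycentric weights of the stretched triangles\<close>

text \<open>A chord with unit direction \<open>u\<close> has \<open>u\<^sup>2 = - z * w\<close>, and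
  \<open>stretch\<close> scales squared lengths along \<open>u\<close> by \<open>(a\<^sup>2 +
  b\<^sup>2) / 2 + (a\<^sup>2 - b\<^sup>2) / 2 * Re (u\<^sup>2)\<close>.\<close>

lemma dist_stretch_unit:
  assumes "cmod z = 1" "cmod w = 1"
  shows "(dist (stretch a b z) (stretch a b w))\<^sup>2 =
    (cmod (z - w))\<^sup>2 * ((a\<^sup>2 + b\<^sup>2) / 2 - (a\<^sup>2 - b\<^sup>2) / 2 * Re (z * w))"
proof -
  obtain x y where z: "z = Complex x y" by (cases z)
  obtain x' y' where w: "w = Complex x' y'" by (cases w)
  have u: "x\<^sup>2 + y\<^sup>2 = 1" "x'\<^sup>2 + y'\<^sup>2 = 1"
    using assms by (simp_all add: z w cmod_def)
  define N where "N = (x - x')\<^sup>2 + (y - y')\<^sup>2"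
  have x: "2 * (x - x')\<^sup>2 = N * (1 - (x * x' - y * y'))"
    and y: "2 * (y - y')\<^sup>2 = N * (1 + (x * x' - y * y'))"
    using u unfolding N_def by algebra+
  have "2 * (dist (stretch a b z) (stretch a b w))\<^sup>2 = a\<^sup>2 * (2 * (x - x')\<^sup>2) + b\<^sup>2 * (2 * (y - y')\<^sup>2)"
    by (simp add: stretch_def z w dist_Pair_Pair dist_real_def power_mult_distrib flip: right_diff_distrib)
  moreover have "(cmod (z - w))\<^sup>2 = N"
    by (simp add: z w cmod_power2 N_def)
  moreover have "Re (z * w) = x * x' - y * y'"
    by (simp add: z w)
  ultimately show ?thesis
    unfolding x y by (simp only:) (simp add: field_simps)
qed

text \<open>Squared chord and scaling factor are both affine in \<open>Re (z1 * z2)\<close>, and the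
  choice of \<open>k\<close> makes them proportional. The squared side is thus a constant times the
  fourth power of the chord.\<close>

lemma blaschke_triple_side:
  assumes k: "0 < k" and K: "(3 - k\<^sup>2) * (a\<^sup>2 - b\<^sup>2) = 2 * k * (a\<^sup>2 + b\<^sup>2)"
    and T: "blaschke_triple k l z1 z2 z3"
  shows "dist (stretch a b z1) (stretch a b z2) = sqrt ((a\<^sup>2 - b\<^sup>2) / (4 * k)) * (cmod (z1 - z2))\<^sup>2"
proof -
  define N R where "N = (cmod (z1 - z2))\<^sup>2" and "R = Re (z1 * z2)"
  have u: "cmod z1 = 1" "cmod z2 = 1" using T by (auto simp: blaschke_triple_def)
  have N: "N = 3 - k\<^sup>2 - 2 * k * R"
    using blaschke_triple_chord[OF T] by (simp add: N_def R_def)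
  have "(a\<^sup>2 + b\<^sup>2) / 2 = (3 - k\<^sup>2) * (a\<^sup>2 - b\<^sup>2) / (4 * k)"
    unfolding K using k by simp
  then have "(a\<^sup>2 + b\<^sup>2) / 2 - (a\<^sup>2 - b\<^sup>2) / 2 * R = (a\<^sup>2 - b\<^sup>2) / (4 * k) * N"
    using k by (simp add: N field_simps)
  then have "(dist (stretch a b z1) (stretch a b z2))\<^sup>2 = (a\<^sup>2 - b\<^sup>2) / (4 * k) * N\<^sup>2"
    using dist_stretch_unit[OF u, of a b] by (simp add: N_def R_def power2_eq_square)
  then have "dist (stretch a b z1) (stretch a b z2) = sqrt ((a\<^sup>2 - b\<^sup>2) / (4 * k) * N\<^sup>2)"
    by (metis real_sqrt_unique zero_le_dist)
  also have "\<dots> = sqrt ((a\<^sup>2 - b\<^sup>2) / (4 * k)) * N"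
    unfolding real_sqrt_mult real_sqrt_abs by (simp add: N_def)
  finally show ?thesis by (simp only: N_def)
qed

text \<open>The signed area is \<open>Im A\<close> up to constants, and \<open>A - cnj A\<close>
  factors into the differences of the vertices because conjugation inverts them.\<close>

lemma nondegenerate_stretch:
  assumes ab: "a \<noteq> 0" "b \<noteq> 0" and u: "cmod z1 = 1" "cmod z2 = 1" "cmod z3 = 1"
    and d: "z1 \<noteq> z2" "z2 \<noteq> z3" "z3 \<noteq> z1"
  shows "nondegenerate (stretch a b z1) (stretch a b z2) (stretch a b z3)"
proof -
  have nz: "z1 \<noteq> 0" "z2 \<noteq> 0" "z3 \<noteq> 0" using u by auto
  have c: "cnj z1 = 1 / z1" "cnj z2 = 1 / z2" "cnj z3 = 1 / z3"
    using u by (simp_all add: divide_conv_cnj)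
  define A where "A = cnj (z2 - z1) * (z3 - z1)"
  have "A - cnj A = (z2 - z1) * (z3 - z1) * (z2 - z3) / (z1 * z2 * z3)"
    using nz by (simp add: A_def c field_simps)
  also have "\<dots> \<noteq> 0" using nz d by simp
  finally have "Im A \<noteq> 0" by (auto simp: complex_eq_iff)
  moreover have "cross2 (stretch a b z2 - stretch a b z1) (stretch a b z3 - stretch a b z1) = a * b * Im A"
    by (simp add: cross2_def stretch_def A_def algebra_simps)
  ultimately show ?thesis using ab by (simp add: nondegenerate_def)
qed

lemma weighted_point_stretch:
  assumes "p + q + r \<noteq> 0"
    and "of_real p * z1 + of_real q * z2 + of_real r * z3 = w * of_real (p + q + r)"
  shows "weighted_point p q r (stretch a b z1) (stretch a b z2) (stretch a b z3) = stretch a b w"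
proof -
  have "p * Re z1 + q * Re z2 + r * Re z3 = Re w * (p + q + r)"
    "p * Im z1 + q * Im z2 + r * Im z3 = Im w * (p + q + r)"
    using assms(2) by (simp_all add: complex_eq_iff)
  then have re: "Re w = (p * Re z1 + q * Re z2 + r * Re z3) / (p + q + r)"
    and im: "Im w = (p * Im z1 + q * Im z2 + r * Im z3) / (p + q + r)"
    using assms(1) by (simp_all add: field_simps)
  show ?thesis
    unfolding weighted_point_def stretch_def re im by (simp add: algebra_simps add_divide_distrib)
qed

text \<open>A point \<open>w\<close> of the circle has trilinears inversely proportional to
  \<open>(w - z1) * (z2 - z3)\<close> etc., once the sides are proportional to \<open>(z2 - z3)\<^sup>2 / (z2 * z3)\<close> etc.\<close>

lemma circle_trilinears:
  fixes z1 z2 z3 w c m :: complex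
  assumes nz: "z1 \<noteq> 0" "z2 \<noteq> 0" "z3 \<noteq> 0" "w \<noteq> 0" "c \<noteq> 0" "m \<noteq> 0"
    and ne: "w \<noteq> z1" "w \<noteq> z2" "w \<noteq> z3" "z1 \<noteq> z2" "z2 \<noteq> z3" "z3 \<noteq> z1"
  defines "p1 \<equiv> m * ((z2 - z3)\<^sup>2 / (z2 * z3)) / (c * (w - z1) * (z2 - z3))"
    and "p2 \<equiv> m * ((z3 - z1)\<^sup>2 / (z3 * z1)) / (c * (w - z2) * (z3 - z1))"
    and "p3 \<equiv> m * ((z1 - z2)\<^sup>2 / (z1 * z2)) / (c * (w - z3) * (z1 - z2))"
  shows "p1 + p2 + p3 \<noteq> 0" and "p1 * z1 + p2 * z2 + p3 * z3 = w * (p1 + p2 + p3)"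
proof -
  define g where "g = m / (c * (z1 * z2 * z3))"
  define W where "W = (w - z1) * (w - z2) * (w - z3)"
  have g: "g \<noteq> 0" and W: "W \<noteq> 0" using nz ne by (simp_all add: g_def W_def)
  have p1: "p1 = g * (z1 * (z2 - z3) * ((w - z2) * (w - z3))) / W"
    and p2: "p2 = g * (z2 * (z3 - z1) * ((w - z3) * (w - z1))) / W"
    and p3: "p3 = g * (z3 * (z1 - z2) * ((w - z1) * (w - z2))) / W"
    using nz ne by (simp_all add: p1_def p2_def p3_def g_def W_def power2_eq_square)
  \<comment> \<open>Over the common denominator \<open>W\<close> the numerators add up to
    \<open>- w\<close> times the nonzero Vandermonde product.\<close>
  have "p1 + p2 + p3 = g * (- (w * ((z1 - z2) * (z2 - z3) * (z3 - z1)))) / W"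
    unfolding p1 p2 p3 add_divide_distrib[symmetric] distrib_left[symmetric]
    by (rule arg_cong[where f = "\<lambda>t. g * t / W"]) algebra
  then show "p1 + p2 + p3 \<noteq> 0" using nz ne g W by simp
  \<comment> \<open>The factors \<open>w - z1\<close> etc. cancel, leaving the cyclic sum of
    \<open>z1 * (z2 - z3)\<close>, which is 0.\<close>
  have "p1 * (w - z1) + p2 * (w - z2) + p3 * (w - z3) = g * 0"
  proof -
    have "p1 * (w - z1) = g * (z1 * (z2 - z3))" "p2 * (w - z2) = g * (z2 * (z3 - z1))"
      "p3 * (w - z3) = g * (z3 * (z1 - z2))"
      unfolding p1 p2 p3 W_def using ne by simp_all
    then show ?thesis by (simp only: distrib_left[symmetric]) (simp add: algebra_simps)
  qed
  then show "p1 * z1 + p2 * z2 + p3 * z3 = w * (p1 + p2 + p3)"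
    by (simp add: algebra_simps)
qed

section \<open>Blaschke triples as 3-periodics, and points of the loci\<close>

text \<open>On the circle, 1 minus the inner product is half the squared chord, and the sides are
  \<open>m\<close> times the squared chords. Hence \<open>J = 1 / (2 * m)\<close> serves all three
  sides.\<close>

lemma blaschke_triple_three_periodic:
  assumes ab: "a \<noteq> 0" "b \<noteq> 0" "b\<^sup>2 < a\<^sup>2" and k: "0 < k" "k < 1"
    and K: "(3 - k\<^sup>2) * (a\<^sup>2 - b\<^sup>2) = 2 * k * (a\<^sup>2 + b\<^sup>2)"
    and T: "blaschke_triple k l z1 z2 z3"
  shows "three_periodic a b (stretch a b z1, stretch a b z2, stretch a b z3)"
proof -
  have T': "blaschke_triple k l z2 z3 z1" "blaschke_triple k l z3 z1 z2"
    using T by (blast intro: blaschke_triple_rotate)+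
  have u: "cmod z1 = 1" "cmod z2 = 1" "cmod z3 = 1"
    using T by (auto simp: blaschke_triple_def)
  have k0: "0 \<le> k" using k by simp
  note distinct = blaschke_triple_distinct[OF k0 k(2)]
  define m where "m = sqrt ((a\<^sup>2 - b\<^sup>2) / (4 * k))"
  have m: "m \<noteq> 0" using ab k by (simp add: m_def)
  have *: "1 - ell_form a b (stretch a b z) (stretch a b w) = 1 / (2 * m) * dist (stretch a b z) (stretch a b w)"
    if "blaschke_triple k l z w v" for z w v
  proof -
    have zw: "(Re z)\<^sup>2 + (Im z)\<^sup>2 = 1" "(Re w)\<^sup>2 + (Im w)\<^sup>2 = 1"
      using that by (simp_all add: blaschke_triple_def cmod_def)
    have "2 * (1 - (Re z * Re w + Im z * Im w)) = (cmod (z - w))\<^sup>2"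
      unfolding cmod_power2 minus_complex.simps using zw by algebra
    then show ?thesis
      using m by (simp add: blaschke_triple_side[OF k(1) K that] ell_form_stretch ab flip: m_def)
  qed
  show ?thesis
    unfolding three_periodic_iff
    using nondegenerate_stretch[OF ab(1,2) u distinct[OF T] distinct[OF T'(1)] distinct[OF T'(2)]]
      *[OF T] *[OF T'(1)] *[OF T'(2)] u ab
    by (intro conjI exI[of _ "1 / (2 * m)"]) (auto simp: ellipse_eq_stretch)
qed

text \<open>The second form replaces \<open>1 / (z1 * z2)\<close> by \<open>z3 / l\<close>, so that
  all sides share the denominator \<open>l\<close> and comparing them is polynomial algebra.\<close>

lemma blaschke_triple_side_complex:
  assumes "0 < k" "(3 - k\<^sup>2) * (a\<^sup>2 - b\<^sup>2) = 2 * k * (a\<^sup>2 + b\<^sup>2)"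
    and T: "blaschke_triple k l z1 z2 z3"
  shows "of_real (dist (stretch a b z1) (stretch a b z2)) =
      - of_real (sqrt ((a\<^sup>2 - b\<^sup>2) / (4 * k))) * ((z1 - z2)\<^sup>2 / (z1 * z2))"
    and "of_real (dist (stretch a b z1) (stretch a b z2)) =
      - of_real (sqrt ((a\<^sup>2 - b\<^sup>2) / (4 * k))) * ((z1 - z2)\<^sup>2 * z3 / l)"
proof -
  show *: "of_real (dist (stretch a b z1) (stretch a b z2)) =
      - of_real (sqrt ((a\<^sup>2 - b\<^sup>2) / (4 * k))) * ((z1 - z2)\<^sup>2 / (z1 * z2))"
    using T unit_diff_norm[of z1 z2] by (simp add: blaschke_triple_side[OF assms] blaschke_triple_def)
  have "z1 * z2 * z3 = l" "z3 \<noteq> 0" using T by (auto simp: blaschke_triple_def)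
  then have "(z1 - z2)\<^sup>2 / (z1 * z2) = (z1 - z2)\<^sup>2 * z3 / l" by auto
  then show "of_real (dist (stretch a b z1) (stretch a b z2)) =
      - of_real (sqrt ((a\<^sup>2 - b\<^sup>2) / (4 * k))) * ((z1 - z2)\<^sup>2 * z3 / l)"
    unfolding * by simp
qed

text \<open>Common criterion for both centers: the denominators must match those of
  \<open>circle_trilinears\<close> up to one factor \<open>c\<close>. The cubic condition says that
  \<open>w\<close> is not a vertex, by \<open>blaschke_triple_prod\<close>.\<close>

lemma stretch_mem_locus:
  assumes ab: "a \<noteq> 0" "b \<noteq> 0" "b\<^sup>2 < a\<^sup>2" and k: "0 < k" "k < 1"
    and K: "(3 - k\<^sup>2) * (a\<^sup>2 - b\<^sup>2) = 2 * k * (a\<^sup>2 + b\<^sup>2)"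
    and T: "blaschke_triple k l z1 z2 z3"
    and w: "w \<noteq> 0" "w ^ 3 + of_real k * l * w\<^sup>2 - of_real k * w - l \<noteq> 0"
    and s: "s1 = dist (stretch a b z2) (stretch a b z3)" "s2 = dist (stretch a b z3) (stretch a b z1)"
      "s3 = dist (stretch a b z1) (stretch a b z2)"
    and c: "c \<noteq> 0"
    and f: "of_real (f s1 s2 s3) = c * (w - z1) * (z2 - z3)" "of_real (f s2 s3 s1) = c * (w - z2) * (z3 - z1)"
      "of_real (f s3 s1 s2) = c * (w - z3) * (z1 - z2)"
  shows "stretch a b w \<in> locus a b (reciprocal_center f)"
proof -
  have T': "blaschke_triple k l z2 z3 z1" "blaschke_triple k l z3 z1 z2"
    using T by (blast intro: blaschke_triple_rotate)+
  have u: "cmod z1 = 1" "cmod z2 = 1" "cmod z3 = 1"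
    using T by (auto simp: blaschke_triple_def)
  then have nz: "z1 \<noteq> 0" "z2 \<noteq> 0" "z3 \<noteq> 0" by auto
  have k0: "0 \<le> k" using k by simp
  note distinct = blaschke_triple_distinct[OF k0 k(2) T] blaschke_triple_distinct[OF k0 k(2) T'(1)]
    blaschke_triple_distinct[OF k0 k(2) T'(2)]
  have wz: "w \<noteq> z1" "w \<noteq> z2" "w \<noteq> z3"
    using w(2) unfolding blaschke_triple_prod[OF T, symmetric] by auto
  have d: "f s1 s2 s3 \<noteq> 0" "f s2 s3 s1 \<noteq> 0" "f s3 s1 s2 \<noteq> 0"
    using f wz distinct c by auto
  define m where "m = sqrt ((a\<^sup>2 - b\<^sup>2) / (4 * k))"
  have m: "- of_real m \<noteq> (0 :: complex)" using ab k by (simp add: m_def)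
  note side = blaschke_triple_side_complex(1)[OF k(1) K, folded m_def]
  define p1 p2 p3 where "p1 = s1 / f s1 s2 s3" and "p2 = s2 / f s2 s3 s1" and "p3 = s3 / f s3 s1 s2"
  have p: "of_real p1 = - of_real m * ((z2 - z3)\<^sup>2 / (z2 * z3)) / (c * (w - z1) * (z2 - z3))"
    "of_real p2 = - of_real m * ((z3 - z1)\<^sup>2 / (z3 * z1)) / (c * (w - z2) * (z3 - z1))"
    "of_real p3 = - of_real m * ((z1 - z2)\<^sup>2 / (z1 * z2)) / (c * (w - z3) * (z1 - z2))"
    unfolding p1_def p2_def p3_def of_real_divide f side[OF T'(1), folded s] side[OF T'(2), folded s]
      side[OF T, folded s] by (rule refl)+
  note circle = circle_trilinears[OF nz w(1) c m wz distinct, folded p]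
  have "of_real (p1 + p2 + p3) \<noteq> (0 :: complex)"
    using circle(1) by simp
  then have sum: "p1 + p2 + p3 \<noteq> 0" by (metis of_real_0)
  have h: "reciprocal_center f s1 s2 s3 = Some (1 / f s1 s2 s3)"
    "reciprocal_center f s2 s3 s1 = Some (1 / f s2 s3 s1)"
    "reciprocal_center f s3 s1 s2 = Some (1 / f s3 s1 s2)"
    using d by (simp_all add: reciprocal_center_def)
  note ctr = center_eq_weighted_point[where h = "reciprocal_center f", OF s h, folded p1_def p2_def p3_def]
  have "weighted_point p1 p2 p3 (stretch a b z1) (stretch a b z2) (stretch a b z3) = stretch a b w"
    using circle(2) by (intro weighted_point_stretch[OF sum]) simp
  with ctr sum blaschke_triple_three_periodic[OF ab k K T]
  show ?thesis unfolding locus_def by (metis (mono_tags, lifting) mem_Collect_eq)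
qed

section \<open>The locus of \<open>X100\<close>\<close>

lemma locus100_mem:
  assumes ab: "a \<noteq> 0" "b \<noteq> 0" "b\<^sup>2 < a\<^sup>2" and k: "0 < k" "k < 1"
    and K: "(3 - k\<^sup>2) * (a\<^sup>2 - b\<^sup>2) = 2 * k * (a\<^sup>2 + b\<^sup>2)"
    and w: "cmod w = 1" "w ^ 4 \<noteq> 1"
  shows "stretch a b w \<in> locus a b h100"
proof -
  define l where "l = 1 / w"
  have wnz: "w \<noteq> 0" using w by auto
  have wl: "w * l = 1" using wnz by (simp add: l_def)
  have l: "cmod l = 1" using w by (simp add: l_def norm_divide)
  then have lnz: "l \<noteq> 0" by auto
  obtain z1 z2 z3 where T: "blaschke_triple k l z1 z2 z3"
    using blaschke_triple_exists[of k l] k l by auto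
  have T': "blaschke_triple k l z2 z3 z1" "blaschke_triple k l z3 z1 z2"
    using T by (blast intro: blaschke_triple_rotate)+
  define m where "m = sqrt ((a\<^sup>2 - b\<^sup>2) / (4 * k))"
  have m: "m \<noteq> 0" using ab k by (simp add: m_def)
  define P where "P = stretch a b"
  note side = blaschke_triple_side_complex(2)[OF k(1) K, folded m_def P_def]
  have *: "of_real (dist (P z) (P x) - dist (P x) (P y)) = - of_real (m * k) * (w - x) * (y - z)"
    if xyz: "blaschke_triple k l x y z" for x y z
  proof -
    have zxy: "blaschke_triple k l z x y" using xyz by (blast intro: blaschke_triple_rotate)
    have e: "x + y + z = - (of_real k * l)" "x * y + y * z + z * x = - of_real k" "x * y * z = l"
      using xyz by (auto simp: blaschke_triple_def)
    \<comment> \<open>The left side is \<open>(y - z) * (x\<^sup>2 - y * z)\<close>, and the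
      symmetric functions give \<open>x\<^sup>2 - y * z = k * (1 - l * x)\<close>.\<close>
    have "(z - x)\<^sup>2 * y - (x - y)\<^sup>2 * z = (y - z) * of_real k * (1 - l * x)"
      using e by algebra
    also have "\<dots> = l * (of_real k * (w - x) * (y - z))"
      using wl by algebra
    finally have "((z - x)\<^sup>2 * y / l - (x - y)\<^sup>2 * z / l) = of_real k * (w - x) * (y - z)"
      using lnz by (simp add: field_simps)
    then show ?thesis
      unfolding of_real_diff side[OF xyz] side[OF zxy] right_diff_distrib[symmetric] by simp
  qed
  \<comment> \<open>With \<open>l = 1 / w\<close> the terms in \<open>k\<close> cancel, so
    \<open>w\<close> is a vertex only at fourth roots of unity.\<close>
  have eq: "w ^ 3 + of_real k * l * w\<^sup>2 - of_real k * w - l = (w ^ 4 - 1) * l"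
    using wl by algebra
  show ?thesis
    unfolding h100_eq
    by (rule stretch_mem_locus[OF ab k K T wnz _ refl refl refl, where c = "- of_real (m * k)"])
      (use *[OF T] *[OF T'(1)] *[OF T'(2)] eq m k w lnz in \<open>simp_all add: P_def\<close>)
qed

section \<open>The locus of \<open>X88\<close>\<close>

text \<open>The cubic is self-inversive: on the unit circle it is a unit factor times a real
  trigonometric sum. Its frequencies 3/2 and 1/2 make that sum change sign over a full turn, so it
  has a zero.\<close>

lemma exists_unit_solution:
  fixes w :: complex and m n :: real
  assumes w: "cmod w = 1"
  shows "\<exists>l. cmod l = 1 \<and> of_real m * l ^ 3 + of_real n * w * l\<^sup>2 + of_real n * l + of_real m * w = 0"
proof -
  obtain p where p: "w = cis p"
    using w by (metis complex_norm_eq_1_exp cis_conv_exp)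
  define g where "g t = m * cos ((3 * t - p) / 2) + n * cos ((t + p) / 2)" for t
  have g: "g (2 * pi) = - g 0"
  proof -
    have "cos ((3 * (2 * pi) - p) / 2) = cos (- p / 2 + pi + 2 * pi)"
      "cos ((2 * pi + p) / 2) = cos (p / 2 + pi)"
      by (simp_all add: field_simps)
    then show ?thesis unfolding g_def cos_periodic cos_periodic_pi by simp
  qed
  have cont: "continuous_on S g" for S
    unfolding g_def by (intro continuous_intros) auto
  have "\<exists>t. g t = 0" \<comment> \<open>\<open>g t\<close> is half the cubic at \<open>cis t\<close> up to the unit factor \<open>cis ((3 * t + p) / 2)\<close>.\<close>
  proof (cases "g 0 \<le> 0")
    case True
    then show ?thesis using IVT'[of g 0 0 "2 * pi"] g cont by auto
  next
    case False
    then show ?thesis using IVT2'[of g "2 * pi" 0 0] g cont by auto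
  qed
  then obtain t where t: "g t = 0" by blast
  have cos: "of_real (2 * cos x) = cis x + cis (- x)" for x
    by (simp add: complex_eq_iff)
  have "of_real m * cis t ^ 3 + of_real n * w * (cis t)\<^sup>2 + of_real n * cis t + of_real m * w
      = of_real m * (cis (3 * t) + cis p) + of_real n * (cis (p + 2 * t) + cis t)"
  proof -
    have "cis t ^ 3 = cis (3 * t)" "(cis t)\<^sup>2 = cis (2 * t)"
      by (simp_all add: Complex.DeMoivre)
    moreover have "cis (p + 2 * t) = cis p * cis (2 * t)"
      by (simp add: cis_mult)
    ultimately show ?thesis
      by (simp add: p algebra_simps)
  qed
  also have "cis (3 * t) + cis p = of_real (2 * cos ((3 * t - p) / 2)) * cis ((3 * t + p) / 2)"
  proof -
    have "(3 * t - p) / 2 + (3 * t + p) / 2 = 3 * t" "- ((3 * t - p) / 2) + (3 * t + p) / 2 = p"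
      by (simp_all add: field_simps)
    then show ?thesis unfolding cos distrib_right cis_mult by simp
  qed
  also have "cis (p + 2 * t) + cis t = of_real (2 * cos ((t + p) / 2)) * cis ((3 * t + p) / 2)"
  proof -
    have "(t + p) / 2 + (3 * t + p) / 2 = p + 2 * t" "- ((t + p) / 2) + (3 * t + p) / 2 = t"
      by (simp_all add: field_simps)
    then show ?thesis unfolding cos distrib_right cis_mult by simp
  qed
  also have "of_real m * (of_real (2 * cos ((3 * t - p) / 2)) * cis ((3 * t + p) / 2)) +
      of_real n * (of_real (2 * cos ((t + p) / 2)) * cis ((3 * t + p) / 2)) =
      of_real (2 * g t) * cis ((3 * t + p) / 2)"
    by (simp add: g_def algebra_simps)
  finally show ?thesis
    using t by (intro exI[of _ "cis t"]) simp
qed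

text \<open>The right side is affine in \<open>z1\<close> with symmetric coefficients, so its zero
  is the same for all three vertices; this zero is the point \<open>w\<close>.\<close>

lemma x88_identity:
  fixes z1 z2 z3 :: "'a::comm_ring_1"
  assumes "e1 = z1 + z2 + z3" "e2 = z1 * z2 + z2 * z3 + z3 * z1" "e3 = z1 * z2 * z3"
  shows "((z3 - z1)\<^sup>2 * z2 + (z1 - z2)\<^sup>2 * z3 - 2 * ((z2 - z3)\<^sup>2 * z1)) * ((z1 - z2) * (z3 - z1)) =
    (6 * e1\<^sup>2 * e3 - 9 * e2 * e3 - e1 * e2\<^sup>2) - (9 * e1 * e3 + e1\<^sup>2 * e2 - 6 * e2\<^sup>2) * z1"
  unfolding assms by (simp add: algebra_simps power2_eq_square)

lemma locus88_mem:
  assumes ab: "a \<noteq> 0" "b \<noteq> 0" "b\<^sup>2 < a\<^sup>2" and k: "0 < k" "k < 1"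
    and K: "(3 - k\<^sup>2) * (a\<^sup>2 - b\<^sup>2) = 2 * k * (a\<^sup>2 + b\<^sup>2)"
    and w: "cmod w = 1" and l: "cmod l = 1"
    and wl: "of_real (6 * k) * l ^ 3 + of_real (9 + k\<^sup>2) * w * l\<^sup>2 + of_real (9 + k\<^sup>2) * l + of_real (6 * k) * w = 0"
    and vertex: "w ^ 3 + of_real k * l * w\<^sup>2 - of_real k * w - l \<noteq> 0"
  shows "stretch a b w \<in> locus a b h88"
proof -
  have wnz: "w \<noteq> 0" and lnz: "l \<noteq> 0" using w l by auto
  have k0: "0 \<le> k" using k by simp
  obtain z1 z2 z3 where T: "blaschke_triple k l z1 z2 z3"
    using blaschke_triple_exists[of k l] k l by auto
  have T': "blaschke_triple k l z2 z3 z1" "blaschke_triple k l z3 z1 z2"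
    using T by (blast intro: blaschke_triple_rotate)+
  define m where "m = sqrt ((a\<^sup>2 - b\<^sup>2) / (4 * k))"
  have m: "m \<noteq> 0" using ab k by (simp add: m_def)
  define P where "P = stretch a b"
  note side = blaschke_triple_side_complex(2)[OF k(1) K, folded m_def P_def]
  \<comment> \<open>The denominator of \<open>w\<close> as a function of \<open>l\<close>:
    assumption \<open>wl\<close> reads
    \<open>w * D = - l * (9 + k\<^sup>2 + 6 * k * l\<^sup>2)\<close>. It could vanish only for
    \<open>9 + k\<^sup>2 = 6 * k\<close>, that is \<open>k = 3\<close>.\<close>
  define D where "D = of_real (9 + k\<^sup>2) * l\<^sup>2 + of_real (6 * k)"
  have D: "D \<noteq> 0"
  proof
    assume "D = 0"
    then have "of_real (9 + k\<^sup>2) * l\<^sup>2 = - of_real (6 * k)"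
      by (simp only: D_def add_eq_0_iff2)
    then have "cmod (of_real (9 + k\<^sup>2) * l\<^sup>2) = cmod (- of_real (6 * k))" by simp
    then have "\<bar>9 + k\<^sup>2\<bar> = \<bar>6 * k\<bar>"
      unfolding norm_mult norm_power norm_minus_cancel norm_of_real l by simp
    then have "(3 - k)\<^sup>2 = 0" using k by (simp add: power2_eq_square algebra_simps)
    then show False using k by simp
  qed
  define V where "V x y z = (x - y) * (y - z) * (z - x)" for x y z :: complex
  have V: "V x y z \<noteq> 0" if "blaschke_triple k l x y z" for x y z
    using that blaschke_triple_distinct[OF k0 k(2)] blaschke_triple_rotate unfolding V_def
    by (metis (no_types) eq_iff_diff_eq_0 mult_eq_0_iff)
  \<comment> \<open>The Vandermonde product \<open>V\<close> is invariant under rotation, so one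
    \<open>c\<close> serves all three denominators.\<close>
  define c where "c = of_real (m * k) * D / (l * V z1 z2 z3)"
  have c: "c \<noteq> 0" using m k D lnz V[OF T] by (simp add: c_def)
  have *: "of_real (dist (P z) (P x) + dist (P x) (P y) - 2 * dist (P y) (P z)) = c * (w - x) * (y - z)"
    if xyz: "blaschke_triple k l x y z" and Veq: "V x y z = V z1 z2 z3" for x y z
  proof -
    have yzx: "blaschke_triple k l y z x" using xyz by (rule blaschke_triple_rotate)
    have zxy: "blaschke_triple k l z x y" using yzx by (rule blaschke_triple_rotate)
    define B where "B = (z - x)\<^sup>2 * y + (x - y)\<^sup>2 * z - 2 * ((y - z)\<^sup>2 * x)"
    have e: "- (of_real k * l) = x + y + z" "- of_real k = x * y + y * z + z * x" "l = x * y * z"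
      using xyz by (auto simp: blaschke_triple_def)
    \<comment> \<open>For a Blaschke triple the coefficients in \<open>x88_identity\<close> become
      \<open>- k * w * D\<close> and \<open>- k * D\<close>.\<close>
    have "B * ((x - y) * (z - x)) = - of_real k * D * (w - x)"
    proof -
      have "w * D = - (of_real (6 * k) * l ^ 3 + of_real (9 + k\<^sup>2) * l)"
        using wl unfolding D_def distrib_left eq_neg_iff_add_eq_0 by (simp only: ac_simps)
      moreover have "- of_real k * D * (w - x) = - of_real k * (w * D) + of_real k * D * x"
        by (simp add: algebra_simps)
      ultimately show ?thesis
        unfolding B_def x88_identity[OF e]
        by (simp only:) (simp add: D_def algebra_simps power2_eq_square power3_eq_cube)
    qed
    moreover have "B * V x y z = B * ((x - y) * (z - x)) * (y - z)"
      by (simp add: V_def mult_ac)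
    ultimately have "B * V x y z = - of_real k * D * (w - x) * (y - z)"
      by (simp only:)
    then have "B = - of_real k * D * (w - x) * (y - z) / V x y z"
      using nonzero_eq_divide_eq[OF V[OF xyz]] by blast
    then have "- of_real m * (B / l) = c * (w - x) * (y - z)"
      by (simp add: c_def Veq[symmetric] mult_ac)
    moreover have "of_real (dist (P z) (P x) + dist (P x) (P y) - 2 * dist (P y) (P z)) =
        - of_real m * (B / l)"
      unfolding of_real_diff of_real_add of_real_mult side[OF xyz] side[OF yzx] side[OF zxy] B_def
      by (simp add: diff_divide_distrib add_divide_distrib algebra_simps)
    ultimately show ?thesis by simp
  qed
  show ?thesis
    unfolding h88_eq
    by (rule stretch_mem_locus[OF ab k K T wnz vertex refl refl refl c])
      (use *[OF T refl] *[OF T'(1)] *[OF T'(2)] in \<open>simp_all add: P_def V_def mult_ac\<close>)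
qed

text \<open>The vertex equation gives \<open>l * d = w * n\<close>. Eliminating \<open>l\<close>
  from the other equation, after multiplication by \<open>d ^ 3\<close>, leaves
  \<open>w * poly R w = 0\<close>; and \<open>R\<close> is nonzero since its constant term is
  \<open>- k * (3 + k\<^sup>2)\<close>.\<close>

lemma finite_locus88_exceptions:
  assumes k: "0 < k" "k < 1"
  shows "finite {w. \<exists>l. cmod w = 1 \<and>
    of_real (6 * k) * l ^ 3 + of_real (9 + k\<^sup>2) * w * l\<^sup>2 + of_real (9 + k\<^sup>2) * l + of_real (6 * k) * w = 0 \<and>
    w ^ 3 + of_real k * l * w\<^sup>2 - of_real k * w - l = 0}" (is "finite ?S")
proof -
  define X N D :: "complex poly" where "X = [:0, 1:]" and "N = [:- of_real k, 0, 1:]"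
    and "D = [:1, 0, - of_real k:]"
  define R where "R = smult (of_real (6 * k)) (X ^ 2 * N ^ 3) + smult (of_real (9 + k\<^sup>2)) (X ^ 2 * N ^ 2 * D)
    + smult (of_real (9 + k\<^sup>2)) (N * D ^ 2) + smult (of_real (6 * k)) (D ^ 3)"
  have "poly R 0 = of_real (- (k * (3 + k\<^sup>2)))"
    by (simp add: R_def X_def N_def D_def algebra_simps power2_eq_square)
  moreover have "k * (3 + k\<^sup>2) > 0" using k by (simp add: add_pos_nonneg)
  ultimately have "R \<noteq> 0"
    by (metis less_irrefl neg_equal_0_iff_equal of_real_eq_0_iff poly_0)
  moreover have "?S \<subseteq> {w. poly R w = 0}"
  proof
    fix w assume "w \<in> ?S"
    then obtain l where w: "cmod w = 1" 
      and Q: "of_real (6 * k) * l ^ 3 + of_real (9 + k\<^sup>2) * w * l\<^sup>2 + of_real (9 + k\<^sup>2) * l + of_real (6 * k) * w = 0"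
      and v: "w ^ 3 + of_real k * l * w\<^sup>2 - of_real k * w - l = 0" by blast
    define n d where "n = poly N w" and "d = poly D w"
    have nd: "n = w\<^sup>2 - of_real k" "d = 1 - of_real k * w\<^sup>2"
      by (simp_all add: n_def d_def N_def D_def power2_eq_square)
    have ld: "l * d = w * n"
      using v by (simp add: nd algebra_simps power2_eq_square power3_eq_cube)
    have "w * poly R w = of_real (6 * k) * (w * n) ^ 3 + of_real (9 + k\<^sup>2) * w * (w * n)\<^sup>2 * d
        + of_real (9 + k\<^sup>2) * (w * n) * d\<^sup>2 + of_real (6 * k) * w * d ^ 3"
      by (simp add: R_def X_def n_def d_def algebra_simps power2_eq_square power3_eq_cube)
    also have "\<dots> = d ^ 3 * (of_real (6 * k) * l ^ 3 + of_real (9 + k\<^sup>2) * w * l\<^sup>2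
        + of_real (9 + k\<^sup>2) * l + of_real (6 * k) * w)"
      unfolding ld[symmetric] by (simp add: algebra_simps power2_eq_square power3_eq_cube)
    also have "\<dots> = 0" unfolding Q by simp
    finally show "w \<in> {w. poly R w = 0}" using w by auto
  qed
  ultimately show ?thesis by (rule finite_subset[OF _ poly_roots_finite, rotated])
qed

theorem theorem1:
  fixes a b :: real
  assumes "a > b" and "b > 0"
  shows "(\<forall>T. three_periodic a b T \<and> center_defined h88 T \<longrightarrow> center h88 T \<in> ellipse a b)
       \<and> (\<forall>T. three_periodic a b T \<and> center_defined h100 T \<longrightarrow> center h100 T \<in> ellipse a b)
       \<and> closure (locus a b h88) = ellipse a b
       \<and> closure (locus a b h100) = ellipse a b"
proof -
  have ab: "a \<noteq> 0" "b \<noteq> 0" "b\<^sup>2 < a\<^sup>2"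
    using assms by (auto intro: power_strict_mono)
  obtain k where k: "0 < k" "k < 1" and K: "(3 - k\<^sup>2) * (a\<^sup>2 - b\<^sup>2) = 2 * k * (a\<^sup>2 + b\<^sup>2)"
    using exists_caustic_parameter[OF assms] by blast
  have 88: "\<forall>T. three_periodic a b T \<and> center_defined h88 T \<longrightarrow> center h88 T \<in> ellipse a b"
    unfolding h88_eq by (intro allI impI reciprocal_center_mem_ellipse) auto
  have 100: "\<forall>T. three_periodic a b T \<and> center_defined h100 T \<longrightarrow> center h100 T \<in> ellipse a b"
    unfolding h100_eq by (intro allI impI reciprocal_center_mem_ellipse) auto
  have "compact (ellipse a b)"
    unfolding ellipse_eq_stretch[OF ab(1,2)]
    by (intro compact_continuous_image continuous_on_stretch compact_sphere)
  then have closed: "closed (ellipse a b)" by (rule compact_imp_closed)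
  have "closure (locus a b h88) \<subseteq> ellipse a b" "closure (locus a b h100) \<subseteq> ellipse a b"
    using 88 100 unfolding locus_def by (intro closure_minimal closed; blast)+
  moreover have "ellipse a b \<subseteq> closure (locus a b h88)"
  proof (rule ellipse_subset_closure[OF ab(1,2) finite_locus88_exceptions[OF k]])
    fix w :: complex
    assume w: "cmod w = 1" and *: "w \<notin> {w. \<exists>l. cmod w = 1 \<and>
      of_real (6 * k) * l ^ 3 + of_real (9 + k\<^sup>2) * w * l\<^sup>2 + of_real (9 + k\<^sup>2) * l +
      of_real (6 * k) * w = 0 \<and>
      w ^ 3 + of_real k * l * w\<^sup>2 - of_real k * w - l = 0}"
    obtain l where l: "cmod l = 1"
      "of_real (6 * k) * l ^ 3 + of_real (9 + k\<^sup>2) * w * l\<^sup>2 + of_real (9 + k\<^sup>2) * l + of_real (6 * k) * w = 0"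
      using exists_unit_solution[OF w, of "6 * k" "9 + k\<^sup>2"] by blast
    from * w l(2) have "w ^ 3 + of_real k * l * w\<^sup>2 - of_real k * w - l \<noteq> 0"
      by blast
    then show "stretch a b w \<in> locus a b h88"
      by (rule locus88_mem[OF ab k K w l])
  qed
  moreover have "ellipse a b \<subseteq> closure (locus a b h100)"
  proof (rule ellipse_subset_closure[OF ab(1,2)])
    have "finite {w :: complex. poly [:- 1, 0, 0, 0, 1:] w = 0}"
      by (rule poly_roots_finite) simp
    then show "finite {w :: complex. w ^ 4 = 1}"
      by (simp add: eval_nat_numeral)
  qed (use locus100_mem[OF ab k K] in blast)
  ultimately show ?thesis using 88 100 by blast
qed

end
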